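(* Let $X$ be a metric space and $\mu$ a positive $\sigma$-finite measure on $X$ such that $0<\mu(B)<\infty$ for every ball $B$ in $X$. Assume that there is a countable family $\mathcal F$ of balls with $\bigcup\mathcal F=X$ such that the non-centered maximal function $\mathcal{M}_\mu f(x)=\sup_{B\ni x}\frac{1}{\mu(B)}\int_B|f|\,d\mu$ (supremum over all balls $B$ of $X$ containing $x$) satisfies $\mathcal M_\mu f(x)=\sup_{B\in\mathcal F,\,B\ni x}\frac1{\mu(B)}\int_B|f|\,d\mu$ for every $\mu$-measurable $f$ and $\mu$-a.e. $x\in X$. Let $p\in\mathcal{P}_\mu(X)$ with $p^->1$. If $\mu(X)=\infty$, assume also that there exists $p_\infty\in[1,\infty)$ such that $1\in L^{s(\cdot)}(\mu)$, where $\frac{1}{s(x)}=\left|\frac1{p(x)}-\frac1{p_\infty}\right|$. If $\mathcal{M}_\mu$ is bounded on $L^{p^-}(\mu)$, then there is a constant $K>0$ such that $$\|\mathcal{M}_\mu f\|_{p(\cdot),\mu}\le K\|f\|_{p(\cdot),\mu}$$ for every $f\in L^{p(\cdot)}(\mu)$.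
   Context: For a $\mu$-measurable bounded function $p:X\to[1,\infty)$ and a $\mu$-measurable set $E$, $p_E^-$ and $p_E^+$ denote the $\mu$-essential infimum and supremum of $p$ on $E$; $p^-=p_X^-$ and $p^+=p_X^+$. The class $\mathcal{P}_\mu(X)$ consists of the $\mu$-measurable bounded $p:X\to[1,\infty)$ for which there is a constant $c_\mu$ with $0<c_\mu<1$ and $\mu(B)^{p_B^+-p_B^-}\ge c_\mu$ for every ball $B$ in $X$. $L^{p(\cdot)}(\mu)$ is the space of $\mu$-measurable $f$ with $\int_X(|f|/\lambda)^{p(x)}d\mu<\infty$ for some $\lambda>0$, with the norm $\|f\|_{p(\cdot),\mu}=\inf\{\lambda>0:\int_X(|f(x)|/\lambda)^{p(x)}d\mu(x)\le1\}$. The exponent $s:X\to[1,\infty]$ may take the value $\infty$ (where $p(x)=p_\infty$); the condition $1\in L^{s(\cdot)}(\mu)$ means that $\int_X(1/\lambda)^{s(x)}d\mu(x)<\infty$ for some $\lambda>1$, with the convention $t^\infty=0$ for $t\in[0,1)$. *)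

theory Defs
  imports "HOL-Analysis.Analysis" "HOL-Probability.Essential_Supremum"
begin

definition balls :: "'a::metric_space set set" where
  "balls = {ball x r |x r. 0 < r}"

definition maximal_over ::
    "'a set set \<Rightarrow> 'a measure \<Rightarrow> ('a \<Rightarrow> 'b::real_normed_vector) \<Rightarrow> 'a \<Rightarrow> ennreal" where
  "maximal_over \<B> M f x =
     (SUP B\<in>{B \<in> \<B>. x \<in> B}. (\<integral>\<^sup>+y\<in>B. ennreal (norm (f y)) \<partial>M) / emeasure M B)"

definition maximal_function ::
    "'a::metric_space measure \<Rightarrow> ('a \<Rightarrow> 'b::real_normed_vector) \<Rightarrow> 'a \<Rightarrow> ennreal" where
  "maximal_function M f = maximal_over balls M f"

definition ess_sup_on :: "'a measure \<Rightarrow> 'a set \<Rightarrow> ('a \<Rightarrow> real) \<Rightarrow> real" where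
  "ess_sup_on M E p = real_of_ereal (esssup (restrict_space M E) (\<lambda>x. ereal (p x)))"

definition ess_inf_on :: "'a measure \<Rightarrow> 'a set \<Rightarrow> ('a \<Rightarrow> real) \<Rightarrow> real" where
  "ess_inf_on M E p = - ess_sup_on M E (\<lambda>x. - p x)"

definition bounded_exponent :: "'a measure \<Rightarrow> ('a \<Rightarrow> real) \<Rightarrow> bool" where
  "bounded_exponent M p \<longleftrightarrow>
     p \<in> borel_measurable M \<and> (\<forall>x\<in>space M. 1 \<le> p x) \<and> (\<exists>b. \<forall>x\<in>space M. p x \<le> b)"

definition class_P :: "'a::metric_space measure \<Rightarrow> ('a \<Rightarrow> real) set" where
  "class_P M = {p. bounded_exponent M p \<and>
     (\<exists>c. 0 < c \<and> c < 1 \<and>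
        (\<forall>B\<in>balls. c \<le> measure M B powr (ess_sup_on M B p - ess_inf_on M B p)))}"

text \<open>The power $a^r$ for $a \in [0,\infty]$ and a real exponent $r > 0$.\<close>

definition ennreal_powr :: "ennreal \<Rightarrow> real \<Rightarrow> ennreal" where
  "ennreal_powr a r = (if a = \<infinity> then \<infinity> else ennreal (enn2real a powr r))"

text \<open>
  Since a maximal function may take the value \<open>\<infinity>\<close>, the norms below are defined for
  \<open>[0,\<infinity>]\<close>-valued functions, to be read as \<open>|f|\<close>. They take values in \<open>[0,\<infinity>]\<close>,
  and a measurable function has norm \<open>\<infinity>\<close> iff it is not in the corresponding space.
\<close>

definition modular :: "'a measure \<Rightarrow> ('a \<Rightarrow> real) \<Rightarrow> ('a \<Rightarrow> ennreal) \<Rightarrow> ennreal" where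
  "modular M p g = (\<integral>\<^sup>+x. ennreal_powr (g x) (p x) \<partial>M)"

definition var_norm :: "'a measure \<Rightarrow> ('a \<Rightarrow> real) \<Rightarrow> ('a \<Rightarrow> ennreal) \<Rightarrow> ennreal" where
  "var_norm M p g =
     Inf {ennreal l |l. 0 < l \<and> modular M p (\<lambda>x. g x / ennreal l) \<le> 1}"

definition var_Lebesgue ::
    "'a measure \<Rightarrow> ('a \<Rightarrow> real) \<Rightarrow> ('a \<Rightarrow> 'b::real_normed_vector) set" where
  "var_Lebesgue M p = {f \<in> borel_measurable M.
     \<exists>l>0. modular M p (\<lambda>x. ennreal (norm (f x)) / ennreal l) < \<infinity>}"

definition Lq_norm :: "'a measure \<Rightarrow> real \<Rightarrow> ('a \<Rightarrow> ennreal) \<Rightarrow> ennreal" where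
  "Lq_norm M q g = ennreal_powr (\<integral>\<^sup>+x. ennreal_powr (g x) q \<partial>M) (1 / q)"

definition Lq_space :: "'a measure \<Rightarrow> real \<Rightarrow> ('a \<Rightarrow> 'b::real_normed_vector) set" where
  "Lq_space M q = {f \<in> borel_measurable M. Lq_norm M q (\<lambda>x. ennreal (norm (f x))) < \<infinity>}"

text \<open>
  The exponent \<open>s\<close> with \<open>1/s(x) = |1/p(x) - 1/p\<^sub>\<infinity>|\<close>; in \<^typ>\<open>ennreal\<close>, \<open>inverse 0 = \<infinity>\<close>.
\<close>

definition decay_exponent :: "('a \<Rightarrow> real) \<Rightarrow> real \<Rightarrow> 'a \<Rightarrow> ennreal" where
  "decay_exponent p p_inf x = inverse (ennreal \<bar>1 / p x - 1 / p_inf\<bar>)"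

text \<open>\<open>1 \<in> L\<^sup>s\<close> for an exponent with values in \<open>[1,\<infinity>]\<close>, where \<open>t\<^sup>\<infinity> = 0\<close> for \<open>0 \<le> t < 1\<close>.\<close>

definition one_in_L :: "'a measure \<Rightarrow> ('a \<Rightarrow> ennreal) \<Rightarrow> bool" where
  "one_in_L M s \<longleftrightarrow>
     (\<exists>l>1. (\<integral>\<^sup>+x. (if s x = \<infinity> then 0 else ennreal ((1 / l) powr enn2real (s x))) \<partial>M) < \<infinity>)"

end

theory Submission
  imports Defs "HOL-Probability.Probability_Measure"
begin

text \<open>
  Put \<open>P = p\<^sup>-\<close> and \<open>q = p / P\<close>.  The norm inequality follows from a pointwise one: if
  \<open>\<integral> |f|\<^sup>p d\<mu> \<le> 1\<close>, then for almost every \<open>x\<close>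
  \<open>(\<beta> * \<M>f(x)) powr q(x) \<le> C * \<M>(|f|\<^sup>q + w)(x) + w(x)\<close>,
  where \<open>w = \<gamma>\<^sup>s\<close> is bounded by \<open>1\<close> and integrable.  Raised to the power \<open>P\<close> and integrated, the
  right-hand side is controlled by the boundedness of the maximal function on the space with
  the constant exponent \<open>P\<close> (\<open>modular_maximal_function_bound\<close>).  The resulting modular bound for
  functions of norm at most \<open>1\<close> gives the norm inequality by homogeneity.

  The pointwise inequality is proved on one ball \<open>B\<close> containing \<open>x\<close> at a time, with constants that
  do not depend on \<open>B\<close>, by splitting \<open>f\<close> at height \<open>1\<close>.

  Where \<open>|f| > 1\<close>, Jensen's inequality is used with the smallest exponent on \<open>B\<close>
  (\<open>powr_average_large_values\<close>).  The passage to the exponent \<open>q(x)\<close> costs at most a power of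
  \<open>1 / \<mu>(B)\<close> whose exponent is the oscillation of \<open>p\<close> on \<open>B\<close>, and this is what the class
  \<open>\<P>\<^sub>\<mu>\<close> bounds.

  Where \<open>|f| \<le> 1\<close>, a smaller exponent gives a larger power and the same argument fails.
  Here every exponent is compared with the limit exponent: Young's inequality shows
  \<open>(\<gamma> t)\<^sup>a \<le> t\<^sup>b + \<gamma>\<^sup>s\<close> for \<open>0 \<le> t \<le> 1\<close> and \<open>1 / s = |1 / a - 1 / b|\<close>
  (\<open>powr_exchange\<close>), and the decay condition is precisely the integrability of the error
  \<open>\<gamma>\<^sup>s\<close> (\<open>exchange_error_summable\<close>).  On a space of finite measure this error is trivially
  integrable, so both cases are treated alike.

  The countable family \<open>\<F>\<close> makes the maximal function almost everywhere equal to a measurable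
  function, and ensures that almost every \<open>x\<close> respects the essential bounds of \<open>p\<close> on all
  balls considered around it.
\<close>

section \<open>Powers of extended nonnegative numbers\<close>

lemma ennreal_powr_ennreal [simp]: "0 \<le> a \<Longrightarrow> ennreal_powr (ennreal a) r = ennreal (a powr r)"
  by (simp add: ennreal_powr_def)

lemma ennreal_powr_top [simp]: "ennreal_powr top r = top"
  by (simp add: ennreal_powr_def)

lemma ennreal_powr_0 [simp]: "ennreal_powr 0 r = 0"
  by (simp add: ennreal_powr_def)

lemma ennreal_powr_mono:
  assumes "a \<le> b" and "0 \<le> r"
  shows "ennreal_powr a r \<le> ennreal_powr b r"
  using assms by (cases a; cases b) (auto simp: top_unique intro!: ennreal_leI powr_mono2)

lemma ennreal_powr_powr: "ennreal_powr (ennreal_powr a r) s = ennreal_powr a (r * s)"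
  by (cases a) (auto simp: powr_powr)

lemma ennreal_powr_one [simp]: "ennreal_powr a 1 = a"
  by (cases a) auto

lemma ennreal_powr_inverse:
  assumes "0 < r"
  shows "ennreal_powr (ennreal_powr a r) (1 / r) = a" "ennreal_powr (ennreal_powr a (1 / r)) r = a"
  using assms by (simp_all add: ennreal_powr_powr)

lemma ennreal_powr_cmult:
  assumes "0 < k"
  shows "ennreal_powr (ennreal k * a) r = ennreal (k powr r) * ennreal_powr a r"
  using assms
  by (cases a) (auto simp: ennreal_mult_top powr_mult simp flip: ennreal_mult)

lemma ennreal_powr_add_le:
  assumes "0 \<le> r"
  shows "ennreal_powr (a + b) r \<le> ennreal (2 powr r) * (ennreal_powr a r + ennreal_powr b r)"
proof -
  have "ennreal_powr (a + b) r \<le> ennreal_powr (ennreal 2 * max a b) r"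
    using assms by (intro ennreal_powr_mono) (auto simp: mult_2 max_def intro: add_mono)
  also have "\<dots> = ennreal (2 powr r) * ennreal_powr (max a b) r"
    by (rule ennreal_powr_cmult) simp
  also have "\<dots> \<le> ennreal (2 powr r) * (ennreal_powr a r + ennreal_powr b r)"
    by (intro mult_left_mono) (auto simp: max_def add_increasing add_increasing2)
  finally show ?thesis .
qed

lemma borel_measurable_ennreal_powr [measurable]:
  assumes [measurable]: "f \<in> borel_measurable M" "r \<in> borel_measurable M"
  shows "(\<lambda>x. ennreal_powr (f x) (r x)) \<in> borel_measurable M"
  unfolding ennreal_powr_def by measurable

section \<open>Averages over a probability measure\<close>

text \<open>
  Jensen's inequality for a power, integrated from the tangent line at the mean \<open>I\<close>:
  \<open>r * I powr (r - 1) * t \<le> t powr r + (r - 1) * I powr r\<close>, which is Young's inequality.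
  Integrating it in \<open>[0,\<infinity>]\<close> also covers an infinite right-hand side.
\<close>

lemma powr_tangent:
  fixes t a r :: real
  assumes "0 \<le> t" "0 < a" "1 \<le> r"
  shows "r * a powr (r - 1) * t \<le> t powr r + (r - 1) * a powr r"
proof (cases "t = 0")
  case True
  then show ?thesis using assms by simp
next
  case False
  with assms have "t > 0" by simp
  have "(t powr r) powr (1 / r) * (a powr r) powr ((r - 1) / r)
      \<le> 1 / r * (t powr r) + (r - 1) / r * (a powr r)"
    using assms \<open>t > 0\<close> by (intro Youngs_inequality_0) (auto simp: field_simps)
  also have "\<dots> = (t powr r + (r - 1) * a powr r) / r"
    using assms by (simp add: add_divide_distrib)
  also have "(t powr r) powr (1 / r) * (a powr r) powr ((r - 1) / r) = t * a powr (r - 1)"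
    using assms \<open>t > 0\<close> by (simp add: powr_powr)
  finally show ?thesis using assms by (simp add: field_simps)
qed

lemma (in prob_space) powr_average_le:
  fixes u :: "'a \<Rightarrow> real"
  assumes [measurable]: "u \<in> borel_measurable M" and u: "\<And>y. 0 \<le> u y"
    and I: "(\<integral>\<^sup>+y. ennreal (u y) \<partial>M) = ennreal I" "0 \<le> I" and r: "1 \<le> r"
  shows "ennreal (I powr r) \<le> (\<integral>\<^sup>+y. ennreal (u y powr r) \<partial>M)"
proof (cases "I = 0")
  case True
  then show ?thesis by simp
next
  case False
  with I have "0 < I" by simp
  let ?c = "r * I powr (r - 1)" and ?d = "(r - 1) * I powr r"
  have cI: "?c * I = I powr r + ?d"
    using \<open>0 < I\<close> by (simp add: powr_diff algebra_simps)
  have "ennreal (I powr r) + ennreal ?d = ennreal (?c * I)"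
    using r cI by simp
  also have "\<dots> = ennreal ?c * (\<integral>\<^sup>+y. ennreal (u y) \<partial>M)"
    using I r by (simp add: ennreal_mult)
  also have "\<dots> = (\<integral>\<^sup>+y. ennreal (?c * u y) \<partial>M)"
    using r u by (simp add: ennreal_mult nn_integral_cmult)
  also have "\<dots> \<le> (\<integral>\<^sup>+y. ennreal (u y powr r) + ennreal ?d \<partial>M)"
    using r u \<open>0 < I\<close>
    by (intro nn_integral_mono) (simp add: powr_tangent flip: ennreal_plus)
  also have "\<dots> = (\<integral>\<^sup>+y. ennreal (u y powr r) \<partial>M) + ennreal ?d"
    by (simp add: nn_integral_add emeasure_space_1)
  finally show ?thesis
    by (simp add: ennreal_add_left_cancel_le add.commute)
qed

text \<open>
  For values that are \<open>0\<close> or at least \<open>1\<close>, lowering the exponent lowers the power, so Jensen's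
  inequality applies with the smallest exponent \<open>a\<close>.  Returning from \<open>a\<close> to \<open>qx\<close> costs a factor
  \<open>J powr (qx / a - 1)\<close>, where \<open>J\<close> is the average of \<open>u powr q\<close>.  It exceeds \<open>1\<close> only if
  \<open>J > 1\<close>, which forces \<open>m < 1\<close>, where \<open>m\<close> stands for the measure of the set averaged over; then
  \<open>J \<le> 1 / m\<close> and the condition on \<open>m powr (b - a)\<close> bound it by \<open>1 / c\<close>.
\<close>

lemma (in prob_space) powr_average_large_values:
  fixes u q :: "'a \<Rightarrow> real"
  assumes [measurable]: "u \<in> borel_measurable M" "q \<in> borel_measurable M"
    and u: "\<And>y. u y = 0 \<or> 1 \<le> u y"
    and I: "(\<integral>\<^sup>+y. ennreal (u y) \<partial>M) = ennreal I" "0 \<le> I"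
    and q: "AE y in M. a \<le> q y" and a: "1 \<le> a" and qx: "a \<le> qx" "qx \<le> b"
    and m: "0 < m" "m < 1 \<Longrightarrow> c \<le> m powr (b - a)" and c: "0 < c" "c \<le> 1"
    and J: "(\<integral>\<^sup>+y. ennreal (u y powr q y) \<partial>M) \<le> ennreal (1 / m)"
  shows "ennreal (I powr qx) \<le> ennreal (1 / c) * (\<integral>\<^sup>+y. ennreal (u y powr q y) \<partial>M)"
proof -
  have u0: "0 \<le> u y" for y using u[of y] by auto
  obtain j where j: "0 \<le> j" "(\<integral>\<^sup>+y. ennreal (u y powr q y) \<partial>M) = ennreal j"
    using J by (cases "\<integral>\<^sup>+y. ennreal (u y powr q y) \<partial>M") (auto simp: top_unique)
  have jm: "j \<le> 1 / m" using J j m by simp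
  have "ennreal (I powr a) \<le> (\<integral>\<^sup>+y. ennreal (u y powr a) \<partial>M)"
    using I a u0 by (intro powr_average_le) auto
  also have "\<dots> \<le> (\<integral>\<^sup>+y. ennreal (u y powr q y) \<partial>M)"
  proof (rule nn_integral_mono_AE, use q in eventually_elim)
    case (elim y)
    then show ?case using u[of y] powr_mono[OF elim, of "u y"] by (auto intro!: ennreal_leI)
  qed
  finally have Ij: "I powr a \<le> j" using j by simp
  have "I powr qx = (I powr a) powr (qx / a)"
    using a by (simp add: powr_powr)
  also have "\<dots> \<le> j powr (qx / a)"
    using Ij a qx by (intro powr_mono2) auto
  also have "\<dots> \<le> 1 / c * j"
  proof (cases "j \<le> 1")
    case True
    have "j powr (qx / a) \<le> j powr 1"
      using True j a qx by (intro powr_mono') auto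
    also have "\<dots> \<le> 1 / c * j"
      using j c by (simp add: field_simps mult_left_le_one_le)
    finally show ?thesis .
  next
    case False
    with jm m have m1: "m < 1" by (smt (verit) divide_le_eq_1)
    have "j powr ((qx - a) / a) \<le> j powr (b - a)"
    proof (rule powr_mono)
      have "(qx - a) / a \<le> (qx - a) / 1"
        using a qx by (intro divide_left_mono) auto
      then show "(qx - a) / a \<le> b - a" using qx by simp
    qed (use False in auto)
    also have "j powr (b - a) \<le> (1 / m) powr (b - a)"
      using jm False qx by (intro powr_mono2) auto
    also have "\<dots> \<le> 1 / c"
      using m m1 c by (simp add: powr_divide frac_le)
    finally have "j * j powr ((qx - a) / a) \<le> j * (1 / c)"
      using j by (intro mult_left_mono)
    moreover have "j powr (qx / a) = j * j powr ((qx - a) / a)"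
      using False a by (simp add: diff_divide_distrib powr_diff)
    ultimately show ?thesis by (simp add: mult.commute)
  qed
  finally show ?thesis
    using j c by (simp flip: ennreal_mult)
qed

section \<open>Changing the exponent of values at most one\<close>

text \<open>
  With \<open>1 / s = \<bar>1 / a - 1 / b\<bar>\<close> this is \<open>\<gamma> powr s\<close>, with value \<open>0\<close> where \<open>s = \<infinity>\<close>: the
  price of replacing the exponent \<open>b\<close> by \<open>a\<close>.
\<close>

definition exchange_error :: "real \<Rightarrow> real \<Rightarrow> real \<Rightarrow> real" where
  "exchange_error \<gamma> a b = (if a = b then 0 else \<gamma> powr (1 / \<bar>1 / a - 1 / b\<bar>))"

lemma exchange_error_nonneg [simp]: "0 \<le> exchange_error \<gamma> a b"
  by (simp add: exchange_error_def)

lemma exchange_error_le_1: "0 \<le> \<gamma> \<Longrightarrow> \<gamma> \<le> 1 \<Longrightarrow> exchange_error \<gamma> a b \<le> 1"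
  by (auto simp: exchange_error_def intro!: powr_le1)

lemma exchange_error_commute: "exchange_error \<gamma> a b = exchange_error \<gamma> b a"
  by (simp add: exchange_error_def abs_minus_commute)

lemma borel_measurable_exchange_error [measurable]:
  assumes [measurable]: "q \<in> borel_measurable M"
  shows "(\<lambda>x. exchange_error \<gamma> (q x) b) \<in> borel_measurable M"
  unfolding exchange_error_def by measurable

text \<open>
  If \<open>b \<le> a\<close> there is nothing to pay.  Otherwise write
  \<open>(\<gamma> * t) powr a = (t powr b) powr \<theta> * (\<gamma> powr s) powr (1 - \<theta>)\<close> with \<open>\<theta> = a / b\<close> and
  \<open>1 / s = 1 / a - 1 / b\<close>, and use Young's inequality.
\<close>

lemma powr_exchange:
  fixes t \<gamma> a b :: real
  assumes t: "0 \<le> t" "t \<le> 1" and \<gamma>: "0 < \<gamma>" "\<gamma> < 1" and ab: "0 < a" "0 < b"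
  shows "(\<gamma> * t) powr a \<le> t powr b + exchange_error \<gamma> a b"
proof (cases "b \<le> a \<or> t = 0")
  case True
  then have "(\<gamma> * t) powr a \<le> t powr b"
  proof
    assume "b \<le> a"
    have "(\<gamma> * t) powr a \<le> t powr a"
      using assms by (intro powr_mono2) (auto simp: mult_left_le_one_le)
    also have "\<dots> \<le> t powr b"
      using assms \<open>b \<le> a\<close> by (intro powr_mono') auto
    finally show ?thesis .
  qed simp
  then show ?thesis by (simp add: add_increasing2)
next
  case False
  then have lt: "a < b" "0 < t" using t by auto
  define s where "s = 1 / (1 / a - 1 / b)"
  have s: "s * (1 - a / b) = a"
    using ab lt by (simp add: s_def field_simps)
  have e: "exchange_error \<gamma> a b = \<gamma> powr s"
    using ab lt by (simp add: exchange_error_def s_def frac_le abs_of_nonneg)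
  have "(\<gamma> * t) powr a = (t powr b) powr (a / b) * (\<gamma> powr s) powr (1 - a / b)"
    using assms s by (simp add: powr_powr powr_mult)
  also have "\<dots> \<le> a / b * (t powr b) + (1 - a / b) * \<gamma> powr s"
    using assms lt by (intro Youngs_inequality_0) (auto simp: field_simps)
  also have "\<dots> \<le> 1 * (t powr b) + 1 * \<gamma> powr s"
    using assms lt by (intro add_mono mult_right_mono) (auto simp: field_simps)
  finally show ?thesis by (simp add: e)
qed

text \<open>
  The exponent is changed twice, with a factor \<open>\<delta>\<close> each time: from \<open>q y\<close> to the constant
  \<open>r\<close> under the integral, where Jensen's inequality applies, and then from \<open>r\<close> to \<open>qx\<close>.
\<close>

lemma (in prob_space) powr_average_small_values:
  fixes u q :: "'a \<Rightarrow> real"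
  assumes [measurable]: "u \<in> borel_measurable M" "q \<in> borel_measurable M"
    and u: "\<And>y. 0 \<le> u y" "\<And>y. u y \<le> 1"
    and I: "(\<integral>\<^sup>+y. ennreal (u y) \<partial>M) = ennreal I" "0 \<le> I"
    and q: "\<And>y. 0 < q y" and qx: "0 < qx" and r: "1 \<le> r" and \<delta>: "0 < \<delta>" "\<delta> < 1"
  shows "ennreal ((\<delta> ^ 2 * I) powr qx)
    \<le> (\<integral>\<^sup>+y. ennreal (u y powr q y + exchange_error \<delta> (q y) r) \<partial>M)
      + ennreal (exchange_error \<delta> qx r)"
proof -
  have "ennreal I \<le> (\<integral>\<^sup>+y. ennreal 1 \<partial>M)"
    unfolding I(1)[symmetric] using u by (intro nn_integral_mono ennreal_leI) auto
  then have I1: "I \<le> 1" by (simp add: emeasure_space_1)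
  have "(\<delta> ^ 2 * I) powr qx = (\<delta> * (\<delta> * I)) powr qx"
    by (simp add: power2_eq_square mult.assoc)
  also have "\<dots> \<le> (\<delta> * I) powr r + exchange_error \<delta> qx r"
    using I I1 \<delta> r qx by (intro powr_exchange) (auto simp: mult_le_one)
  finally have "ennreal ((\<delta> ^ 2 * I) powr qx)
      \<le> ennreal ((\<delta> * I) powr r) + ennreal (exchange_error \<delta> qx r)"
    by (simp flip: ennreal_plus)
  moreover have "ennreal ((\<delta> * I) powr r) \<le> (\<integral>\<^sup>+y. ennreal ((\<delta> * u y) powr r) \<partial>M)"
    using I u \<delta> r by (intro powr_average_le) (auto simp: ennreal_mult nn_integral_cmult)
  moreover have "(\<integral>\<^sup>+y. ennreal ((\<delta> * u y) powr r) \<partial>M)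
      \<le> (\<integral>\<^sup>+y. ennreal (u y powr q y + exchange_error \<delta> (q y) r) \<partial>M)"
    using u q \<delta> r
    by (intro nn_integral_mono ennreal_leI)
       (simp add: powr_exchange exchange_error_commute[of \<delta> _ r])
  ultimately show ?thesis
    by (meson add_right_mono order_trans)
qed

text \<open>
  The two estimates combined, by splitting \<open>f\<close> at height \<open>1\<close>.  The factor \<open>1 / 2\<close> pays for
  \<open>((s + t) / 2) powr qx \<le> s powr qx + t powr qx\<close>.
\<close>

lemma (in prob_space) powr_average_variable_exponent:
  fixes f q :: "'a \<Rightarrow> real"
  assumes [measurable]: "f \<in> borel_measurable M" "q \<in> borel_measurable M"
    and f: "\<And>y. 0 \<le> f y" and q0: "\<And>y. 0 < q y"
    and q: "AE y in M. a \<le> q y" and a: "1 \<le> a" and qx: "a \<le> qx" "qx \<le> b"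
    and m: "0 < m" "m < 1 \<Longrightarrow> c \<le> m powr (b - a)" and c: "0 < c" "c \<le> 1"
    and J: "(\<integral>\<^sup>+y. ennreal ((if 1 < f y then f y else 0) powr q y) \<partial>M) \<le> ennreal (1 / m)"
    and r: "1 \<le> r" and \<delta>: "0 < \<delta>" "\<delta> < 1"
  shows "ennreal_powr (ennreal (\<delta> ^ 2 / 2) * (\<integral>\<^sup>+y. ennreal (f y) \<partial>M)) qx
    \<le> ennreal (1 / c + 1) * (\<integral>\<^sup>+y. ennreal (f y powr q y + exchange_error \<delta> (q y) r) \<partial>M)
      + ennreal (exchange_error \<delta> qx r)"
proof -
  let ?g = "\<lambda>y. if 1 < f y then f y else 0" and ?h = "\<lambda>y. if 1 < f y then 0 else f y"
  let ?E = "\<integral>\<^sup>+y. ennreal (f y powr q y + exchange_error \<delta> (q y) r) \<partial>M"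
  have "(\<integral>\<^sup>+y. ennreal (?g y) \<partial>M) \<le> (\<integral>\<^sup>+y. ennreal (?g y powr q y) \<partial>M)"
  proof (rule nn_integral_mono_AE, use q in eventually_elim)
    case (elim y)
    then show ?case using a powr_mono[of 1 "q y" "f y"] by (auto intro!: ennreal_leI)
  qed
  also note J
  finally obtain I where I: "(\<integral>\<^sup>+y. ennreal (?g y) \<partial>M) = ennreal I" "0 \<le> I"
    by (cases "\<integral>\<^sup>+y. ennreal (?g y) \<partial>M") (auto simp: top_unique)
  have "(\<integral>\<^sup>+y. ennreal (?h y) \<partial>M) \<le> (\<integral>\<^sup>+y. 1 \<partial>M)"
    by (intro nn_integral_mono) auto
  then obtain K where K: "(\<integral>\<^sup>+y. ennreal (?h y) \<partial>M) = ennreal K" "0 \<le> K"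
    by (cases "\<integral>\<^sup>+y. ennreal (?h y) \<partial>M") (auto simp: top_unique emeasure_space_1)
  have "(\<integral>\<^sup>+y. ennreal (f y) \<partial>M) = (\<integral>\<^sup>+y. ennreal (?g y) + ennreal (?h y) \<partial>M)"
    by (intro nn_integral_cong) auto
  also have "\<dots> = ennreal (I + K)"
    using I K f by (subst nn_integral_add) auto
  finally have IK: "(\<integral>\<^sup>+y. ennreal (f y) \<partial>M) = ennreal (I + K)" .
  have "ennreal (I powr qx) \<le> ennreal (1 / c) * (\<integral>\<^sup>+y. ennreal (?g y powr q y) \<partial>M)"
    using I q a qx m c J by (intro powr_average_large_values[where a = a and b = b and m = m]) auto
  also have "\<dots> \<le> ennreal (1 / c) * ?E"
    by (intro mult_left_mono nn_integral_mono ennreal_leI) (auto simp: add_increasing2)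
  finally have 1: "ennreal (I powr qx) \<le> ennreal (1 / c) * ?E" .
  have "ennreal ((\<delta> ^ 2 * K) powr qx)
      \<le> (\<integral>\<^sup>+y. ennreal (?h y powr q y + exchange_error \<delta> (q y) r) \<partial>M)
        + ennreal (exchange_error \<delta> qx r)"
    using f q0 K r \<delta> a qx by (intro powr_average_small_values) auto
  also have "\<dots> \<le> ?E + ennreal (exchange_error \<delta> qx r)"
    by (intro add_right_mono nn_integral_mono ennreal_leI) auto
  finally have 2: "ennreal ((\<delta> ^ 2 * K) powr qx) \<le> ?E + ennreal (exchange_error \<delta> qx r)" .
  have "\<delta> ^ 2 / 2 * (I + K) \<le> max I (\<delta> ^ 2 * K)"
  proof -
    have "\<delta> ^ 2 * I \<le> I" using I \<delta> by (simp add: mult_left_le_one_le power_le_one)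
    then show ?thesis by (simp add: algebra_simps)
  qed
  then have "(\<delta> ^ 2 / 2 * (I + K)) powr qx \<le> max I (\<delta> ^ 2 * K) powr qx"
    using I K a qx by (intro powr_mono2) auto
  also have "\<dots> \<le> I powr qx + (\<delta> ^ 2 * K) powr qx"
    by (simp add: max_def)
  finally have "ennreal ((\<delta> ^ 2 / 2 * (I + K)) powr qx)
      \<le> ennreal (I powr qx) + ennreal ((\<delta> ^ 2 * K) powr qx)"
    by (simp flip: ennreal_plus)
  also have "\<dots> \<le> ennreal (1 / c) * ?E + (?E + ennreal (exchange_error \<delta> qx r))"
    by (rule add_mono[OF 1 2])
  also have "\<dots> = ennreal (1 / c + 1) * ?E + ennreal (exchange_error \<delta> qx r)"
    using c by (simp add: ennreal_plus distrib_right add.assoc)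
  also have "ennreal ((\<delta> ^ 2 / 2 * (I + K)) powr qx)
      = ennreal_powr (ennreal (\<delta> ^ 2 / 2) * (\<integral>\<^sup>+y. ennreal (f y) \<partial>M)) qx"
    unfolding IK using I K by (subst ennreal_mult[symmetric]) auto
  finally show ?thesis .
qed

section \<open>Essential bounds of the exponent\<close>

lemma AE_le_ess_sup_on:
  assumes E: "E \<in> sets M" and [measurable]: "p \<in> borel_measurable M" and b: "\<And>x. p x \<le> b"
  shows "AE x in M. x \<in> E \<longrightarrow> p x \<le> ess_sup_on M E p"
proof -
  let ?N = "restrict_space M E" and ?s = "esssup (restrict_space M E) (\<lambda>x. ereal (p x))"
  have [measurable]: "p \<in> borel_measurable ?N"
    by (simp add: measurable_restrict_space1)
  have "?s \<le> ereal b"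
    using b by (intro esssup_I) auto
  moreover have "AE x in M. x \<in> E \<longrightarrow> ereal (p x) \<le> ?s"
    using esssup_AE[of "\<lambda>x. ereal (p x)" ?N] E by (subst (asm) AE_restrict_space_iff) auto
  ultimately show ?thesis
    unfolding ess_sup_on_def by (elim AE_mp; intro AE_I2; cases ?s) auto
qed

lemma AE_ess_inf_on_le:
  assumes "E \<in> sets M" and "p \<in> borel_measurable M" and "\<And>x. a \<le> p x"
  shows "AE x in M. x \<in> E \<longrightarrow> ess_inf_on M E p \<le> p x"
  using AE_le_ess_sup_on[of E M "\<lambda>x. - p x" "- a"] assms
  by (auto simp: ess_inf_on_def elim!: AE_mp)

section \<open>The decay condition\<close>

lemma exchange_error_rescale:
  assumes "0 < P" "0 \<le> \<gamma>"
  shows "exchange_error (\<gamma> powr P) (a / P) (b / P) = exchange_error \<gamma> a b"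
proof -
  have "\<bar>P / a - P / b\<bar> = P * \<bar>1 / a - 1 / b\<bar>"
    using assms by (simp add: abs_mult_pos' right_diff_distrib)
  then show ?thesis
    using assms by (simp add: exchange_error_def powr_powr)
qed

text \<open>
  The limit exponent may be raised to \<open>r \<ge> P\<close>: where \<open>p x \<ge> P\<close>, the number \<open>1 / max p_inf P\<close>
  is at least as close to \<open>1 / p x\<close> as \<open>1 / p_inf\<close> is.  Then \<open>r / P \<ge> 1\<close>, as Jensen's
  inequality with that exponent requires.  On a space of finite measure every \<open>r\<close> and
  every \<open>\<gamma> < 1\<close> will do, because the error is at most \<open>1\<close>.
\<close>

lemma exchange_error_summable:
  assumes P: "1 \<le> P" "AE x in M. P \<le> p x"
    and decay: "emeasure M (space M) = \<infinity> \<longrightarrow> (\<exists>p_inf\<ge>1. one_in_L M (decay_exponent p p_inf))"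
  obtains \<gamma> r where "0 < \<gamma>" "\<gamma> < 1" "P \<le> r"
    and "(\<integral>\<^sup>+x. ennreal (exchange_error \<gamma> (p x) r) \<partial>M) < \<infinity>"
proof (cases "emeasure M (space M) = \<infinity>")
  case False
  have "(\<integral>\<^sup>+x. ennreal (exchange_error (1 / 2) (p x) P) \<partial>M) \<le> (\<integral>\<^sup>+x. 1 \<partial>M)"
    by (intro nn_integral_mono) (simp add: exchange_error_le_1)
  also have "\<dots> < \<infinity>"
    using False by (simp add: less_top)
  finally show ?thesis
    using that[of "1 / 2" P] by simp
next
  case True
  then obtain p' l where p': "1 \<le> p'" and l: "1 < l" and fin:
    "(\<integral>\<^sup>+x. (if decay_exponent p p' x = \<infinity> then 0
        else ennreal ((1 / l) powr enn2real (decay_exponent p p' x))) \<partial>M) < \<infinity>"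
    using decay by (auto simp: one_in_L_def)
  let ?r = "max p' P"
  have "(\<integral>\<^sup>+x. ennreal (exchange_error (1 / l) (p x) ?r) \<partial>M) \<le>
    (\<integral>\<^sup>+x. (if decay_exponent p p' x = \<infinity> then 0
        else ennreal ((1 / l) powr enn2real (decay_exponent p p' x))) \<partial>M)"
  proof (rule nn_integral_mono_AE, use P(2) in eventually_elim)
    case (elim x)
    define d where "d = \<bar>1 / p x - 1 / p'\<bar>"
    define d' where "d' = \<bar>1 / p x - 1 / ?r\<bar>"
    have "d' \<le> d"
    proof (cases "P \<le> p'")
      case False
      then have "1 / P \<le> 1 / p'" "1 / p x \<le> 1 / P"
        using P(1) p' elim by (auto intro!: divide_left_mono)
      then show ?thesis using False by (simp add: d_def d'_def max_def)
    qed (simp add: d_def d'_def max_def)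
    have d'0: "d' = 0 \<longleftrightarrow> p x = ?r"
      using elim P(1) p' by (auto simp: d'_def)
    have D: "decay_exponent p p' x = (if d = 0 then \<infinity> else ennreal (1 / d))"
      by (auto simp: decay_exponent_def d_def inverse_ennreal inverse_eq_divide simp del: abs_divide)
    have "0 \<le> d'" by (simp add: d'_def)
    moreover have "(1 / l) powr (1 / d') \<le> (1 / l) powr (1 / d)" if "0 < d'"
      using that \<open>d' \<le> d\<close> l by (intro powr_mono') (auto simp: frac_le)
    ultimately show ?case
      using \<open>d' \<le> d\<close> d'0 unfolding D exchange_error_def d'_def[symmetric]
      by (auto simp: d_def intro!: ennreal_leI)
  qed
  also note fin
  finally show ?thesis
    using that[of "1 / l" ?r] l by simp
qed

section \<open>Maximal functions\<close>

lemma average_le_maximal_over: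
  assumes "B \<in> \<B>" "x \<in> B"
  shows "(\<integral>\<^sup>+y\<in>B. ennreal (norm (f y)) \<partial>M) / emeasure M B \<le> maximal_over \<B> M f x"
  unfolding maximal_over_def using assms by (intro SUP_upper) auto

lemma maximal_over_scaleR:
  fixes f :: "'a \<Rightarrow> 'b::real_normed_vector"
  assumes [measurable]: "f \<in> borel_measurable M" and \<B>: "\<B> \<subseteq> sets M" and k: "0 \<le> k"
  shows "maximal_over \<B> M (\<lambda>y. k *\<^sub>R f y) x = ennreal k * maximal_over \<B> M f x"
proof -
  have "(\<integral>\<^sup>+y\<in>B. ennreal (norm (k *\<^sub>R f y)) \<partial>M) / emeasure M B
      = ennreal k * ((\<integral>\<^sup>+y\<in>B. ennreal (norm (f y)) \<partial>M) / emeasure M B)" if "B \<in> \<B>" for B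
  proof -
    have [measurable]: "B \<in> sets M" using that \<B> by auto
    show ?thesis
      using k by (simp add: ennreal_mult nn_integral_cmult mult.assoc ennreal_times_divide)
  qed
  then show ?thesis
    unfolding maximal_over_def by (subst SUP_mult_left_ennreal) (auto intro!: SUP_cong)
qed

lemma borel_measurable_maximal_over:
  assumes F: "countable \<F>" "\<F> \<subseteq> sets M"
  shows "maximal_over \<F> M f \<in> borel_measurable M"
proof -
  define A where "A B = (\<integral>\<^sup>+y\<in>B. ennreal (norm (f y)) \<partial>M) / emeasure M B" for B
  have "maximal_over \<F> M f x = (SUP B\<in>\<F>. A B * indicator B x)" for x
  proof (rule antisym)
    show "maximal_over \<F> M f x \<le> (SUP B\<in>\<F>. A B * indicator B x)"
      unfolding maximal_over_def A_def[symmetric] by (rule SUP_mono) (auto split: split_indicator)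
    show "(SUP B\<in>\<F>. A B * indicator B x) \<le> maximal_over \<F> M f x"
      unfolding A_def
      by (rule SUP_least) (auto split: split_indicator intro: average_le_maximal_over)
  qed
  moreover have "(\<lambda>x. SUP B\<in>\<F>. A B * indicator B x) \<in> borel_measurable M"
    using F by (intro borel_measurable_SUP) auto
  ultimately show ?thesis
    by (simp cong: measurable_cong)
qed

text \<open>
  The average estimate holds on each set \<open>B \<in> \<F>\<close> around \<open>x\<close> with the same right-hand side, so it
  passes to the supremum.  The bounds \<open>a \<le> q \<le> b\<close> may depend on \<open>B\<close>.
\<close>

lemma maximal_over_powr_le:
  fixes f :: "'a \<Rightarrow> 'b::real_normed_vector" and g :: "'a \<Rightarrow> 'c::real_normed_vector"
  assumes \<F>: "\<And>B. B \<in> \<F> \<Longrightarrow> B \<in> sets M \<and> 0 < emeasure M B \<and> emeasure M B < \<infinity>"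
    and [measurable]: "f \<in> borel_measurable M" "q \<in> borel_measurable M"
    and g: "\<And>y. norm (g y) = norm (f y) powr q y + exchange_error \<delta> (q y) r"
    and q0: "\<And>y. 0 < q y"
    and J: "(\<integral>\<^sup>+y. ennreal ((if 1 < norm (f y) then norm (f y) else 0) powr q y) \<partial>M) \<le> 1"
    and ab: "\<And>B. B \<in> \<F> \<Longrightarrow> x \<in> B \<Longrightarrow> \<exists>a b. 1 \<le> a \<and> (AE y in M. y \<in> B \<longrightarrow> a \<le> q y) \<and>
      a \<le> q x \<and> q x \<le> b \<and> (measure M B < 1 \<longrightarrow> c \<le> measure M B powr (b - a))"
    and c: "0 < c" "c \<le> 1" and r: "1 \<le> r" and \<delta>: "0 < \<delta>" "\<delta> < 1"
  shows "ennreal_powr (ennreal (\<delta> ^ 2 / 2) * maximal_over \<F> M f x) (q x)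
    \<le> ennreal (1 / c + 1) * maximal_over \<F> M g x + ennreal (exchange_error \<delta> (q x) r)"
    (is "_ \<le> ?R")
proof -
  have "ennreal (\<delta> ^ 2 / 2) * ((\<integral>\<^sup>+y\<in>B. ennreal (norm (f y)) \<partial>M) / emeasure M B)
      \<le> ennreal_powr ?R (1 / q x)" if B: "B \<in> \<F>" "x \<in> B" for B
  proof -
    let ?N = "uniform_measure M B"
    have [measurable]: "B \<in> sets M" and B0: "emeasure M B \<noteq> 0" "emeasure M B \<noteq> \<infinity>"
      using \<F>[OF B(1)] by auto
    interpret N: prob_space ?N using B0 by (rule prob_space_uniform_measure)
    define m where "m = measure M B"
    have m: "emeasure M B = ennreal m" "0 < m"
      using B0 by (auto simp: m_def emeasure_eq_ennreal_measure zero_less_measure_iff)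
    have average: "(\<integral>\<^sup>+y. h y \<partial>?N) = (\<integral>\<^sup>+y\<in>B. h y \<partial>M) / emeasure M B"
      if "h \<in> borel_measurable M" for h
      using that by (simp add: nn_integral_uniform_measure)
    obtain a b where a: "1 \<le> a" "AE y in M. y \<in> B \<longrightarrow> a \<le> q y" "a \<le> q x" "q x \<le> b"
      and m1: "m < 1 \<Longrightarrow> c \<le> m powr (b - a)"
      using ab[OF B] unfolding m_def by blast
    have "AE y in ?N. a \<le> q y"
      using a(2) by (intro AE_uniform_measureI) auto
    moreover have "(\<integral>\<^sup>+y. ennreal ((if 1 < norm (f y) then norm (f y) else 0) powr q y) \<partial>?N)
        \<le> ennreal (1 / m)"
    proof -
      have "(\<integral>\<^sup>+y\<in>B. ennreal ((if 1 < norm (f y) then norm (f y) else 0) powr q y) \<partial>M)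
          \<le> (\<integral>\<^sup>+y. ennreal ((if 1 < norm (f y) then norm (f y) else 0) powr q y) \<partial>M)"
        by (intro nn_integral_mono) (auto split: split_indicator)
      also note J
      finally have "(\<integral>\<^sup>+y\<in>B. ennreal ((if 1 < norm (f y) then norm (f y) else 0) powr q y) \<partial>M)
          / ennreal m \<le> 1 / ennreal m"
        by (rule divide_right_mono_ennreal)
      then show ?thesis
        using m by (simp add: average ennreal_1[symmetric] divide_ennreal del: ennreal_1)
    qed
    ultimately have "ennreal_powr (ennreal (\<delta> ^ 2 / 2) * (\<integral>\<^sup>+y. ennreal (norm (f y)) \<partial>?N)) (q x)
      \<le> ennreal (1 / c + 1) * (\<integral>\<^sup>+y. ennreal (norm (f y) powr q y + exchange_error \<delta> (q y) r) \<partial>?N)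
        + ennreal (exchange_error \<delta> (q x) r)"
      using a m m1 c r \<delta> q0
      by (intro N.powr_average_variable_exponent[where a = a and b = b and m = m]) auto
    also have "\<dots> \<le> ?R"
      using average_le_maximal_over[OF B, where f = g and M = M]
      by (subst average) (auto simp: g intro!: add_right_mono mult_left_mono)
    finally have "ennreal_powr (ennreal_powr
        (ennreal (\<delta> ^ 2 / 2) * (\<integral>\<^sup>+y. ennreal (norm (f y)) \<partial>?N)) (q x)) (1 / q x)
        \<le> ennreal_powr ?R (1 / q x)"
      using q0[of x] by (intro ennreal_powr_mono) auto
    then show ?thesis
      using q0[of x] by (simp only: ennreal_powr_inverse average) (simp add: average)
  qed
  then have "ennreal (\<delta> ^ 2 / 2) * maximal_over \<F> M f x \<le> ennreal_powr ?R (1 / q x)"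
    unfolding maximal_over_def[of _ _ f] by (subst SUP_mult_left_ennreal) (auto intro!: SUP_least)
  then have "ennreal_powr (ennreal (\<delta> ^ 2 / 2) * maximal_over \<F> M f x) (q x)
      \<le> ennreal_powr (ennreal_powr ?R (1 / q x)) (q x)"
    using q0[of x] by (intro ennreal_powr_mono) (auto simp: less_imp_le)
  then show ?thesis
    using q0[of x] by (simp only: ennreal_powr_inverse)
qed

section \<open>The constant-exponent bound\<close>

lemma nn_integral_powr_le_of_Lq_norm_le:
  assumes q: "0 < q" and C: "0 < C" and le: "Lq_norm M q g \<le> ennreal C * Lq_norm M q h"
  shows "(\<integral>\<^sup>+x. ennreal_powr (g x) q \<partial>M) \<le> ennreal (C powr q) * (\<integral>\<^sup>+x. ennreal_powr (h x) q \<partial>M)"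
proof -
  have "ennreal_powr (Lq_norm M q g) q \<le> ennreal_powr (ennreal C * Lq_norm M q h) q"
    using le q by (intro ennreal_powr_mono) auto
  then show ?thesis
    using q C by (simp add: Lq_norm_def ennreal_powr_cmult ennreal_powr_inverse)
qed

lemma ennreal_powr_less_top: "a < \<infinity> \<Longrightarrow> ennreal_powr a r < \<infinity>"
  by (simp add: ennreal_powr_def)

lemma powr_add_le:
  fixes a b r :: real
  assumes "0 \<le> a" "0 \<le> b" "0 \<le> r"
  shows "(a + b) powr r \<le> 2 powr r * (a powr r + b powr r)"
  using ennreal_powr_add_le[of r "ennreal a" "ennreal b"] assms
  by (simp flip: ennreal_plus ennreal_mult)

text \<open>
  The maximal function need not itself be measurable, so its modular is controlled through a
  measurable majorant \<open>G\<close>, built from the countable supremum \<open>maximal_over \<F> M g\<close>.  With \<open>q = p / P\<close> and \<open>w\<close> the exchange error, the function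
  \<open>g = |h|\<^sup>q + w\<close> is bounded in \<open>L\<^sup>P\<close>, since \<open>|h|\<^sup>q\<close> to the power \<open>P\<close> is \<open>|h|\<^sup>p\<close> and
  \<open>w \<le> 1\<close> is integrable.  The pointwise bound by \<open>C\<^sub>1 * \<M> g + w\<close>, raised to the power \<open>P\<close>,
  then integrates by the boundedness of the maximal function on \<open>L\<^sup>P\<close>.
\<close>

lemma modular_maximal_function_bound:
  fixes M :: "'a::metric_space measure" and p :: "'a \<Rightarrow> real"
  assumes UNIV: "space M = UNIV"
    and balls: "\<forall>B\<in>balls. B \<in> sets M \<and> 0 < emeasure M B \<and> emeasure M B < \<infinity>"
    and \<F>: "countable \<F>" "\<F> \<subseteq> balls"
    and M\<F>: "\<forall>f :: 'a \<Rightarrow> complex. f \<in> borel_measurable M \<longrightarrow>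
           (AE x in M. maximal_function M f x = maximal_over \<F> M f x)"
    and p [measurable]: "p \<in> borel_measurable M" and p_bounds: "\<And>x. 1 \<le> p x" "\<And>x. p x \<le> pb"
    and c: "0 < c" "c \<le> 1"
    and cB: "\<And>B. B \<in> balls \<Longrightarrow> c \<le> measure M B powr (ess_sup_on M B p - ess_inf_on M B p)"
    and P: "1 \<le> P" "AE x in M. P \<le> p x"
    and decay: "emeasure M UNIV = \<infinity> \<longrightarrow> (\<exists>p_inf\<ge>1. one_in_L M (decay_exponent p p_inf))"
    and C: "0 < C" "\<forall>f :: 'a \<Rightarrow> complex. f \<in> Lq_space M P \<longrightarrow>
           Lq_norm M P (maximal_function M f) \<le> ennreal C * Lq_norm M P (\<lambda>x. ennreal (norm (f x)))"
  obtains \<beta> K where "0 < \<beta>" "1 \<le> K"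
    and "\<And>h :: 'a \<Rightarrow> complex. h \<in> borel_measurable M \<Longrightarrow>
      (\<integral>\<^sup>+x. ennreal (norm (h x) powr p x) \<partial>M) \<le> 1 \<Longrightarrow>
      \<exists>G \<in> borel_measurable M. (AE x in M. ennreal_powr (ennreal \<beta> * maximal_function M h x) (p x) \<le> G x)
        \<and> (\<integral>\<^sup>+x. G x \<partial>M) \<le> ennreal K"
proof -
  obtain \<gamma> r where \<gamma>: "0 < \<gamma>" "\<gamma> < 1" and r: "P \<le> r"
    and w_fin: "(\<integral>\<^sup>+x. ennreal (exchange_error \<gamma> (p x) r) \<partial>M) < \<infinity>"
    using exchange_error_summable[where P = P and M = M and p = p] P decay UNIV by auto
  define w where "w x = exchange_error \<gamma> (p x) r" for x
  have [measurable]: "w \<in> borel_measurable M"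
    unfolding w_def by measurable
  have w: "0 \<le> w x" "w x \<le> 1" for x
    using \<gamma> by (auto simp: w_def exchange_error_le_1)
  have w_powr: "w x powr P \<le> w x" for x
    using powr_mono'[of 1 P "w x"] w[of x] P by simp
  obtain W where W: "0 \<le> W" "(\<integral>\<^sup>+x. ennreal (w x) \<partial>M) = ennreal W"
    using w_fin unfolding w_def by (cases "\<integral>\<^sup>+x. ennreal (exchange_error \<gamma> (p x) r) \<partial>M") auto
  define q where "q x = p x / P" for x
  have [measurable]: "q \<in> borel_measurable M"
    unfolding q_def by measurable
  define \<delta> where "\<delta> = \<gamma> powr P"
  have \<delta>: "0 < \<delta>" "\<delta> < 1"
    using \<gamma> P powr_less_mono2[of P \<gamma> 1] by (auto simp: \<delta>_def)
  have w_q: "w x = exchange_error \<delta> (q x) (r / P)" for x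
    unfolding w_def \<delta>_def q_def using \<gamma> P by (subst exchange_error_rescale) auto
  define C1 where "C1 = 1 / c + 1"
  have C1: "0 < C1" using c by (simp add: C1_def add_pos_pos)
  define D where "D = C powr P * (2 powr P * (1 + W))"
  have D: "0 \<le> D" using W by (simp add: D_def)
  define K where "K = max 1 (2 powr P * (C1 powr P * D + W))"
  have \<F>B: "B \<in> sets M \<and> 0 < emeasure M B \<and> emeasure M B < \<infinity>" if "B \<in> \<F>" for B
    using that \<F> balls by blast
  \<comment> \<open>The essential bounds hold almost everywhere on each ball; as \<open>\<F>\<close> is countable, almost every
    \<open>x\<close> satisfies them on all members of \<open>\<F>\<close> around it.  The maximum with \<open>P\<close> gives the lower
    bound \<open>1\<close> after division by \<open>P\<close>; where \<open>\<mu>(B) < 1\<close>, the shorter exponent interval only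
    weakens the condition on \<open>\<mu>(B)\<close>.\<close>
  have local_bounds: "AE x in M. \<forall>B\<in>\<F>. x \<in> B \<longrightarrow> (\<exists>a b. 1 \<le> a \<and> (AE y in M. y \<in> B \<longrightarrow> a \<le> q y) \<and>
      a \<le> q x \<and> q x \<le> b \<and> (measure M B < 1 \<longrightarrow> c \<le> measure M B powr (b - a)))"
    unfolding AE_ball_countable[OF \<F>(1)]
  proof
    fix B assume B: "B \<in> \<F>"
    let ?i = "ess_inf_on M B p" and ?s = "ess_sup_on M B p"
    have lower: "AE x in M. x \<in> B \<longrightarrow> max ?i P / P \<le> q x"
    proof -
      have "AE x in M. x \<in> B \<longrightarrow> ?i \<le> p x"
        using AE_ess_inf_on_le[of B M p 1] \<F>B[OF B] p_bounds by auto
      with P(2) show ?thesis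
        by eventually_elim (use P in \<open>auto simp: q_def divide_right_mono\<close>)
    qed
    have "AE x in M. x \<in> B \<longrightarrow> p x \<le> ?s"
      using AE_le_ess_sup_on[of B M p pb] \<F>B[OF B] p_bounds by auto
    with lower show "AE x in M. x \<in> B \<longrightarrow> (\<exists>a b. 1 \<le> a \<and> (AE y in M. y \<in> B \<longrightarrow> a \<le> q y) \<and>
      a \<le> q x \<and> q x \<le> b \<and> (measure M B < 1 \<longrightarrow> c \<le> measure M B powr (b - a)))"
    proof eventually_elim
      case (elim x)
      show ?case
      proof (intro impI exI conjI)
        assume x: "x \<in> B"
        show "1 \<le> max ?i P / P" using P by simp
        show "max ?i P / P \<le> q x" "q x \<le> ?s / P"
          using elim x P by (auto simp: q_def divide_right_mono)
        then have ord: "max ?i P \<le> ?s" using P by (simp add: q_def divide_le_cancel order_trans)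
        assume m: "measure M B < 1"
        have "(?s - max ?i P) / P \<le> (?s - max ?i P) / 1"
          using P ord by (intro divide_left_mono) auto
        then have "?s / P - max ?i P / P \<le> ?s - ?i" by (simp add: diff_divide_distrib)
        then have "measure M B powr (?s - ?i) \<le> measure M B powr (?s / P - max ?i P / P)"
          using m by (intro powr_mono') auto
        then show "c \<le> measure M B powr (?s / P - max ?i P / P)"
          using cB[of B] B \<F> by auto
      qed (rule lower)
    qed
  qed
  have main: "\<exists>G \<in> borel_measurable M.
      (AE x in M. ennreal_powr (ennreal (\<delta> ^ 2 / 2) * maximal_function M h x) (p x) \<le> G x)
        \<and> (\<integral>\<^sup>+x. G x \<partial>M) \<le> ennreal K"
    if [measurable]: "h \<in> borel_measurable M" and h: "(\<integral>\<^sup>+x. ennreal (norm (h x) powr p x) \<partial>M) \<le> 1"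
    for h :: "'a \<Rightarrow> complex"
  proof -
    define g where "g y = complex_of_real (norm (h y) powr q y + w y)" for y
    have g: "norm (g y) = norm (h y) powr q y + w y" for y
      using w[of y] by (simp add: g_def del: of_real_add)
    have [measurable]: "g \<in> borel_measurable M"
      unfolding g_def by measurable
    have [measurable]: "maximal_over \<F> M g \<in> borel_measurable M"
      using \<F> \<F>B by (intro borel_measurable_maximal_over) auto
    define G where "G x = ennreal (2 powr P) *
      (ennreal (C1 powr P) * ennreal_powr (maximal_over \<F> M g x) P + ennreal (w x))" for x
    have "(\<integral>\<^sup>+x. ennreal_powr (ennreal (norm (g x))) P \<partial>M)
        \<le> (\<integral>\<^sup>+x. ennreal (2 powr P) * (ennreal (norm (h x) powr p x) + ennreal (w x)) \<partial>M)"
    proof (rule nn_integral_mono)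
      fix x
      have "(norm (h x) powr q x + w x) powr P
          \<le> 2 powr P * ((norm (h x) powr q x) powr P + w x powr P)"
        using w P by (intro powr_add_le) auto
      also have "\<dots> \<le> 2 powr P * (norm (h x) powr p x + w x)"
        using P w_powr[of x] by (simp add: powr_powr q_def)
      finally show "ennreal_powr (ennreal (norm (g x))) P
          \<le> ennreal (2 powr P) * (ennreal (norm (h x) powr p x) + ennreal (w x))"
        using w by (simp add: g flip: ennreal_plus ennreal_mult)
    qed
    also have "\<dots> = ennreal (2 powr P) * ((\<integral>\<^sup>+x. ennreal (norm (h x) powr p x) \<partial>M) + ennreal W)"
      by (simp add: nn_integral_cmult nn_integral_add W)
    also have "\<dots> \<le> ennreal (2 powr P) * (1 + ennreal W)"
      by (intro mult_left_mono add_right_mono h) simp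
    also have "\<dots> = ennreal (2 powr P * (1 + W))"
      using W by (simp add: ennreal_mult)
    finally have g_le: "(\<integral>\<^sup>+x. ennreal_powr (ennreal (norm (g x))) P \<partial>M) \<le> ennreal (2 powr P * (1 + W))" .
    then have "(\<integral>\<^sup>+x. ennreal_powr (ennreal (norm (g x))) P \<partial>M) < \<infinity>"
      by (rule le_less_trans) simp
    then have "Lq_norm M P (\<lambda>x. ennreal (norm (g x))) < \<infinity>"
      unfolding Lq_norm_def by (rule ennreal_powr_less_top)
    then have "g \<in> Lq_space M P"
      by (simp add: Lq_space_def)
    then have "Lq_norm M P (maximal_function M g) \<le> ennreal C * Lq_norm M P (\<lambda>x. ennreal (norm (g x)))"
      using C by blast
    then have "(\<integral>\<^sup>+x. ennreal_powr (maximal_function M g x) P \<partial>M)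
        \<le> ennreal (C powr P) * (\<integral>\<^sup>+x. ennreal_powr (ennreal (norm (g x))) P \<partial>M)"
      using P C by (intro nn_integral_powr_le_of_Lq_norm_le) auto
    also have "\<dots> \<le> ennreal (C powr P) * ennreal (2 powr P * (1 + W))"
      by (intro mult_left_mono g_le) simp
    also have "\<dots> = ennreal D"
      using W by (simp add: D_def ennreal_mult)
    also have "(\<integral>\<^sup>+x. ennreal_powr (maximal_function M g x) P \<partial>M)
        = (\<integral>\<^sup>+x. ennreal_powr (maximal_over \<F> M g x) P \<partial>M)"
    proof (rule nn_integral_cong_AE)
      have "AE x in M. maximal_function M g x = maximal_over \<F> M g x"
        using M\<F> by simp
      then show "AE x in M. ennreal_powr (maximal_function M g x) P = ennreal_powr (maximal_over \<F> M g x) P"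
        by eventually_elim simp
    qed
    finally have Mg: "(\<integral>\<^sup>+x. ennreal_powr (maximal_over \<F> M g x) P \<partial>M) \<le> ennreal D" .
    have "(\<integral>\<^sup>+x. G x \<partial>M) = ennreal (2 powr P) *
        (ennreal (C1 powr P) * (\<integral>\<^sup>+x. ennreal_powr (maximal_over \<F> M g x) P \<partial>M) + ennreal W)"
      unfolding G_def by (simp add: nn_integral_cmult nn_integral_add W)
    also have "\<dots> \<le> ennreal (2 powr P) * (ennreal (C1 powr P) * ennreal D + ennreal W)"
      by (intro mult_left_mono add_right_mono Mg) simp_all
    also have "\<dots> = ennreal (2 powr P * (C1 powr P * D + W))"
      using W D by (simp add: ennreal_mult)
    also have "\<dots> \<le> ennreal K"
      by (intro ennreal_leI) (simp add: K_def)
    finally have GK: "(\<integral>\<^sup>+x. G x \<partial>M) \<le> ennreal K" .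
    have J: "(\<integral>\<^sup>+y. ennreal ((if 1 < norm (h y) then norm (h y) else 0) powr q y) \<partial>M) \<le> 1"
    proof -
      have "q y \<le> p y" for y
        using P p_bounds(1)[of y] by (simp add: q_def divide_le_eq mult_le_cancel_left1)
      then have "(\<integral>\<^sup>+y. ennreal ((if 1 < norm (h y) then norm (h y) else 0) powr q y) \<partial>M)
          \<le> (\<integral>\<^sup>+y. ennreal (norm (h y) powr p y) \<partial>M)"
        by (intro nn_integral_mono ennreal_leI) (auto intro: powr_mono)
      also note h
      finally show ?thesis .
    qed
    have "AE x in M. maximal_function M h x = maximal_over \<F> M h x"
      using M\<F> by simp
    with local_bounds
    have "AE x in M. ennreal_powr (ennreal (\<delta> ^ 2 / 2) * maximal_function M h x) (p x) \<le> G x"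
    proof eventually_elim
      case (elim x)
      have "ennreal_powr (ennreal (\<delta> ^ 2 / 2) * maximal_over \<F> M h x) (q x)
          \<le> ennreal C1 * maximal_over \<F> M g x + ennreal (exchange_error \<delta> (q x) (r / P))"
        unfolding C1_def
      proof (rule maximal_over_powr_le)
        show "norm (g y) = norm (h y) powr q y + exchange_error \<delta> (q y) (r / P)" for y
          by (simp add: g w_q)
        show "0 < q y" for y
          using P p_bounds(1)[of y] by (simp add: q_def)
        show "1 \<le> r / P" using r P by simp
      qed (use \<F>B J elim(1) c \<delta> in auto)
      then have "ennreal_powr (ennreal_powr (ennreal (\<delta> ^ 2 / 2) * maximal_over \<F> M h x) (q x)) P
          \<le> ennreal_powr (ennreal C1 * maximal_over \<F> M g x + ennreal (w x)) P"
        unfolding w_q using P by (intro ennreal_powr_mono) auto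
      also have "\<dots> \<le> ennreal (2 powr P) *
          (ennreal_powr (ennreal C1 * maximal_over \<F> M g x) P + ennreal_powr (ennreal (w x)) P)"
        using P by (intro ennreal_powr_add_le) auto
      also have "\<dots> \<le> G x"
        unfolding G_def using C1 w[of x] w_powr[of x]
        by (intro mult_left_mono add_mono) (auto simp: ennreal_powr_cmult ennreal_leI)
      finally show ?case
        using P elim(2) by (simp add: ennreal_powr_powr q_def)
    qed
    moreover have "G \<in> borel_measurable M"
      unfolding G_def by measurable
    ultimately show ?thesis using GK by blast
  qed
  show ?thesis
  proof (rule that)
    show "0 < \<delta> ^ 2 / 2" "1 \<le> K" using \<delta> by (auto simp: K_def)
  qed (rule main)
qed

section \<open>From the modular to the norm\<close>

lemma le_cmult_Inf_ennreal:
  fixes v :: ennreal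
  assumes K: "0 < K" and le: "\<And>s. s \<in> S \<Longrightarrow> v \<le> ennreal K * s"
  shows "v \<le> ennreal K * Inf S"
proof -
  have "ennreal (1 / K) * v \<le> Inf S"
  proof (rule Inf_greatest)
    fix s assume "s \<in> S"
    then have "ennreal (1 / K) * v \<le> ennreal (1 / K) * (ennreal K * s)"
      using le by (intro mult_left_mono) auto
    also have "\<dots> = s"
      using K by (simp add: mult.assoc[symmetric] flip: ennreal_mult)
    finally show "ennreal (1 / K) * v \<le> s" .
  qed
  then have "ennreal K * (ennreal (1 / K) * v) \<le> ennreal K * Inf S"
    by (rule mult_left_mono) simp
  then show ?thesis
    using K by (simp add: mult.assoc[symmetric] flip: ennreal_mult)
qed

text \<open>
  As \<open>p \<ge> 1\<close>, division of a function by \<open>K \<ge> 1\<close> divides its modular by at least \<open>K\<close>; this turns a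
  bound \<open>K\<close> of the modular into a bound of the norm.
\<close>

lemma ennreal_powr_contract:
  assumes "1 \<le> K" "1 \<le> r"
  shows "ennreal_powr (ennreal (1 / K) * a) r \<le> ennreal (1 / K) * ennreal_powr a r"
proof -
  have "(1 / K) powr r \<le> (1 / K) powr 1"
    using assms by (intro powr_mono') auto
  then show ?thesis
    using assms by (subst ennreal_powr_cmult) (auto intro!: mult_right_mono ennreal_leI)
qed

theorem theorem5p2:
  fixes M :: "'a::metric_space measure"
    and \<F> :: "'a set set"
    and p :: "'a \<Rightarrow> real"
  assumes "space M = UNIV"
    and "sigma_finite_measure M"
    and "\<forall>B\<in>balls. B \<in> sets M \<and> 0 < emeasure M B \<and> emeasure M B < \<infinity>"
    and "countable \<F>" and "\<F> \<subseteq> balls" and "\<Union>\<F> = UNIV"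
    and "\<forall>f :: 'a \<Rightarrow> complex. f \<in> borel_measurable M \<longrightarrow>
           (AE x in M. maximal_function M f x = maximal_over \<F> M f x)"
    and "p \<in> class_P M"
    and "1 < ess_inf_on M UNIV p"
    and "emeasure M UNIV = \<infinity> \<longrightarrow> (\<exists>p_inf\<ge>1. one_in_L M (decay_exponent p p_inf))"
    and "\<exists>C>0. \<forall>f :: 'a \<Rightarrow> complex. f \<in> Lq_space M (ess_inf_on M UNIV p) \<longrightarrow>
           Lq_norm M (ess_inf_on M UNIV p) (maximal_function M f)
             \<le> ennreal C * Lq_norm M (ess_inf_on M UNIV p) (\<lambda>x. ennreal (norm (f x)))"
  shows "\<exists>K>0. \<forall>f :: 'a \<Rightarrow> complex. f \<in> var_Lebesgue M p \<longrightarrow>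
           var_norm M p (maximal_function M f)
             \<le> ennreal K * var_norm M p (\<lambda>x. ennreal (norm (f x)))"
proof -
  obtain C where C: "C > 0" "\<forall>f :: 'a \<Rightarrow> complex. f \<in> Lq_space M (ess_inf_on M UNIV p) \<longrightarrow>
           Lq_norm M (ess_inf_on M UNIV p) (maximal_function M f)
             \<le> ennreal C * Lq_norm M (ess_inf_on M UNIV p) (\<lambda>x. ennreal (norm (f x)))"
    using assms(11) by blast
  obtain c where c: "0 < c" "c < 1"
    and cB: "\<And>B. B \<in> balls \<Longrightarrow> c \<le> measure M B powr (ess_sup_on M B p - ess_inf_on M B p)"
    using \<open>p \<in> class_P M\<close> by (auto simp: class_P_def)
  obtain b where p: "p \<in> borel_measurable M" "\<And>x. 1 \<le> p x" "\<And>x. p x \<le> b"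
    using \<open>p \<in> class_P M\<close> \<open>space M = UNIV\<close> by (auto simp: class_P_def bounded_exponent_def)
  have "AE x in M. ess_inf_on M UNIV p \<le> p x"
    using AE_ess_inf_on_le[of UNIV M p 1] p sets.top[of M] \<open>space M = UNIV\<close> by simp
  from modular_maximal_function_bound[OF assms(1,3,4,5,7) p c(1) less_imp_le[OF c(2)] cB
      less_imp_le[OF assms(9)] this assms(10) C]
  obtain \<beta> K where \<beta>: "0 < \<beta>" and K: "1 \<le> K"
    and bound: "\<And>h :: 'a \<Rightarrow> complex. h \<in> borel_measurable M \<Longrightarrow>
      (\<integral>\<^sup>+x. ennreal (norm (h x) powr p x) \<partial>M) \<le> 1 \<Longrightarrow>
      \<exists>G \<in> borel_measurable M. (AE x in M. ennreal_powr (ennreal \<beta> * maximal_function M h x) (p x) \<le> G x)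
        \<and> (\<integral>\<^sup>+x. G x \<partial>M) \<le> ennreal K"
    by blast
  have balls: "balls \<subseteq> sets M" using assms(3) by auto
  have "var_norm M p (maximal_function M f)
      \<le> ennreal (K / \<beta>) * var_norm M p (\<lambda>x. ennreal (norm (f x)))"
    if [measurable]: "f \<in> borel_measurable M" for f :: "'a \<Rightarrow> complex"
    unfolding var_norm_def[of M p "\<lambda>x. ennreal (norm (f x))"]
  proof (rule le_cmult_Inf_ennreal)
    show "0 < K / \<beta>" using K \<beta> by simp
    fix s assume "s \<in> {ennreal l |l. 0 < l \<and> modular M p (\<lambda>x. ennreal (norm (f x)) / ennreal l) \<le> 1}"
    then obtain l where s: "s = ennreal l" and l: "0 < l"
      and mod: "modular M p (\<lambda>x. ennreal (norm (f x)) / ennreal l) \<le> 1"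
      by blast
    \<comment> \<open>Every admissible \<open>l\<close> for \<open>f\<close> yields the admissible \<open>K / \<beta> * l\<close> for the maximal function.\<close>
    define h where "h x = (1 / l) *\<^sub>R f x" for x
    have [measurable]: "h \<in> borel_measurable M"
      unfolding h_def by measurable
    have "(\<integral>\<^sup>+x. ennreal (norm (h x) powr p x) \<partial>M) \<le> 1"
      using mod l by (simp add: modular_def h_def divide_ennreal)
    then obtain G where [measurable]: "G \<in> borel_measurable M"
      and G: "AE x in M. ennreal_powr (ennreal \<beta> * maximal_function M h x) (p x) \<le> G x"
        "(\<integral>\<^sup>+x. G x \<partial>M) \<le> ennreal K"
      using bound[of h] by auto
    have scale: "maximal_function M f x / ennreal (K / \<beta> * l)
        = ennreal (1 / K) * (ennreal \<beta> * maximal_function M h x)" for x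
    proof -
      have "maximal_function M h x = ennreal (1 / l) * maximal_function M f x"
        unfolding h_def[abs_def] maximal_function_def
        using l balls by (intro maximal_over_scaleR) auto
      then have "ennreal (1 / K) * (ennreal \<beta> * maximal_function M h x)
          = ennreal (1 / K * \<beta> * (1 / l)) * maximal_function M f x"
        using K \<beta> l by (simp add: mult.assoc[symmetric] flip: ennreal_mult)
      also have "\<dots> = maximal_function M f x * inverse (ennreal (K / \<beta> * l))"
        using K \<beta> l by (simp add: inverse_ennreal field_simps)
      finally show ?thesis by (simp add: divide_ennreal_def)
    qed
    have "modular M p (\<lambda>x. maximal_function M f x / ennreal (K / \<beta> * l))
        \<le> (\<integral>\<^sup>+x. ennreal (1 / K) * G x \<partial>M)"
      unfolding modular_def scale
    proof (rule nn_integral_mono_AE, use G(1) in eventually_elim)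
      case (elim x)
      have "ennreal_powr (ennreal (1 / K) * (ennreal \<beta> * maximal_function M h x)) (p x)
          \<le> ennreal (1 / K) * ennreal_powr (ennreal \<beta> * maximal_function M h x) (p x)"
        using K p by (intro ennreal_powr_contract) auto
      also have "\<dots> \<le> ennreal (1 / K) * G x"
        using elim by (intro mult_left_mono) auto
      finally show ?case .
    qed
    also have "\<dots> = ennreal (1 / K) * (\<integral>\<^sup>+x. G x \<partial>M)"
      by (simp add: nn_integral_cmult)
    also have "\<dots> \<le> ennreal (1 / K) * ennreal K"
      by (intro mult_left_mono G) simp
    also have "\<dots> = 1"
      using K by (simp flip: ennreal_mult)
    finally have "var_norm M p (maximal_function M f) \<le> ennreal (K / \<beta> * l)"
      unfolding var_norm_def using K \<beta> l by (intro Inf_lower) auto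
    then show "var_norm M p (maximal_function M f) \<le> ennreal (K / \<beta>) * s"
      using K \<beta> l by (simp add: s flip: ennreal_mult)
  qed
  moreover have "0 < K / \<beta>" using K \<beta> by simp
  ultimately show ?thesis
    by (auto simp: var_Lebesgue_def)
qed

end
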